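(* Let $\mathcal{H}_1,\mathcal{H}_2$ be complex separable Hilbert spaces and let $A:\operatorname{dom}(A)\subseteq\mathcal{H}_1\to\mathcal{H}_2$ be a densely defined, closed, linear operator. Let $B:\operatorname{dom}(B)\subseteq\mathcal{H}_1\to\mathcal{H}_1$ be a closed operator which commutes with $|A|$ in the sense that $B|A|\subseteq|A|B$. In addition, let $R$ be a densely defined, closable operator in $\mathcal{H}_1$ satisfying $\operatorname{dom}(R)\supseteq\operatorname{dom}(A)$. Suppose $u:[0,\infty)\to\mathcal{H}_1$ is a classical solution of $$\ddot u+R\dot u+A^*Au=0$$ such that $B|A|u(\cdot)\in C^1([0,\infty);\mathcal{H}_1)$, $B\dot u(\cdot)\in C^1([0,\infty);\mathcal{H}_1)$, and $R\dot u(t)\in\operatorname{dom}(B)$ for all $t\ge0$. Then $$\frac{d}{dt}\big[\|B\dot u\|_{\mathcal{H}_1}^2+\|ABu\|_{\mathcal{H}_2}^2\big]=-2\operatorname{Re}\,(B\dot u,BR\dot u)_{\mathcal{H}_1}.$$ In particular, the right-hand side vanishes if $R=0$, and hence in that case $\|B\dot u\|_{\mathcal{H}_1}^2+\|ABu\|_{\mathcal{H}_2}^2$ is a conserved quantity (constant in $t$) for $\ddot u+A^*Au=0$.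
   Context: $|A|=(A^*A)^{1/2}$, with $\operatorname{dom}(|A|)=\operatorname{dom}(A)$. Dots denote derivatives with respect to $t$. A classical solution $u:[0,\infty)\to\mathcal{H}_1$ of $\ddot u+R\dot u+Su=0$ (here $S=A^*A$) is a map satisfying: $u\in C^2([0,\infty);\mathcal{H}_1)$; $u(t)\in\operatorname{dom}(S)$ for $t\geq0$ and $Su\in C([0,\infty);\mathcal{H}_1)$; $\dot u(t)\in\operatorname{dom}(R)$ for $t\geq0$ and $R\dot u\in C([0,\infty);\mathcal{H}_1)$; and the equation holds for all $t\ge0$. *)

theory Defs
  imports "HOL-Analysis.Analysis"
begin

text \<open>
  The underlying real Hilbert space of a complex inner product space has the inner product
  \<open>Re (cinner x y)\<close>. The complex inner product is linear in its second argument.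
\<close>

class complex_inner = real_inner +
  fixes scaleC :: "complex \<Rightarrow> 'a \<Rightarrow> 'a"  (infixr \<open>*\<^sub>C\<close> 75)
    and cinner :: "'a \<Rightarrow> 'a \<Rightarrow> complex"
  assumes scaleC_add_right: "c *\<^sub>C (x + y) = c *\<^sub>C x + c *\<^sub>C y"
    and scaleC_add_left: "(c + d) *\<^sub>C x = c *\<^sub>C x + d *\<^sub>C x"
    and scaleC_scaleC: "c *\<^sub>C (d *\<^sub>C x) = (c * d) *\<^sub>C x"
    and scaleC_of_real: "complex_of_real r *\<^sub>C x = r *\<^sub>R x"
    and cinner_commute: "cinner x y = cnj (cinner y x)"
    and cinner_add_right: "cinner x (y + z) = cinner x y + cinner x z"
    and cinner_scaleC_right: "cinner x (c *\<^sub>C y) = c * cinner x y"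
    and inner_eq_Re_cinner: "inner x y = Re (cinner x y)"

class complex_hilbert = complex_inner + complete_space

instantiation complex :: complex_hilbert
begin

definition scaleC_complex :: "complex \<Rightarrow> complex \<Rightarrow> complex"
  where "scaleC_complex c x = c * x"

definition cinner_complex :: "complex \<Rightarrow> complex \<Rightarrow> complex"
  where "cinner_complex x y = cnj x * y"

instance
  by standard
    (auto simp: scaleC_complex_def cinner_complex_def inner_complex_def algebra_simps
      scaleR_conv_of_real)

end

text \<open>
  An unbounded operator is represented by its graph: its domain is \<open>Domain A\<close>, inclusion of
  operators is inclusion of graphs, and an operator is closed iff its graph is a closed set.
\<close>

type_synonym ('a, 'b) op_graph = "('a \<times> 'b) set"

definition linear_operator :: "('a::complex_inner, 'b::complex_inner) op_graph \<Rightarrow> bool" where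
  "linear_operator A \<longleftrightarrow>
     single_valued A \<and>
     (0, 0) \<in> A \<and>
     (\<forall>x y x' y'. (x, y) \<in> A \<longrightarrow> (x', y') \<in> A \<longrightarrow> (x + x', y + y') \<in> A) \<and>
     (\<forall>c x y. (x, y) \<in> A \<longrightarrow> (c *\<^sub>C x, c *\<^sub>C y) \<in> A)"

text \<open>Only meaningful for \<open>x \<in> Domain A\<close>.\<close>

definition app :: "('a, 'b) op_graph \<Rightarrow> 'a \<Rightarrow> 'b" where
  "app A x = (THE y. (x, y) \<in> A)"

text \<open>
  Operator product on its natural domain; note that \<open>O\<close> composes from left to right.
\<close>

abbreviation op_comp :: "('b, 'c) op_graph \<Rightarrow> ('a, 'b) op_graph \<Rightarrow> ('a, 'c) op_graph"
    (infixr \<open>\<odot>\<close> 75) where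
  "B \<odot> A \<equiv> A O B"

definition densely_defined :: "('a::topological_space, 'b) op_graph \<Rightarrow> bool" where
  "densely_defined A \<longleftrightarrow> closure (Domain A) = UNIV"

definition closable :: "('a::topological_space, 'b::topological_space) op_graph \<Rightarrow> bool" where
  "closable A \<longleftrightarrow> single_valued (closure A)"

text \<open>The adjoint is itself (the graph of) an operator iff \<open>A\<close> is densely defined.\<close>

definition adjoint_op :: "('a::complex_inner, 'b::complex_inner) op_graph \<Rightarrow> ('b, 'a) op_graph"
  where "adjoint_op A = {(y, z). \<forall>(x, w) \<in> A. cinner w y = cinner x z}"

definition nonneg_selfadjoint :: "('a::complex_inner, 'a) op_graph \<Rightarrow> bool" where
  "nonneg_selfadjoint T \<longleftrightarrow>
     linear_operator T \<and> densely_defined T \<and> adjoint_op T = T \<and>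
     (\<forall>(x, y) \<in> T. 0 \<le> Re (cinner x y))"

text \<open>
  A nonnegative self-adjoint operator on a Hilbert space has exactly one nonnegative
  self-adjoint square root, so no choice is involved when \<open>S\<close> is such an operator.
\<close>

definition sqrt_op :: "('a::complex_inner, 'a) op_graph \<Rightarrow> ('a, 'a) op_graph" where
  "sqrt_op S = (SOME T. nonneg_selfadjoint T \<and> T \<odot> T = S)"

definition abs_op :: "('a::complex_inner, 'b::complex_inner) op_graph \<Rightarrow> ('a, 'a) op_graph" where
  "abs_op A = sqrt_op (adjoint_op A \<odot> A)"

text \<open>
  Differentiation on \<open>[0, \<infinity>)\<close>, one-sided at \<open>0\<close>; the values of functions at negative
  arguments are irrelevant.
\<close>

definition tderiv :: "(real \<Rightarrow> 'a::real_normed_vector) \<Rightarrow> real \<Rightarrow> 'a" where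
  "tderiv f t = vector_derivative f (at t within {0..})"

definition C1 :: "(real \<Rightarrow> 'a::real_normed_vector) \<Rightarrow> bool" where
  "C1 f \<longleftrightarrow> f differentiable_on {0..} \<and> continuous_on {0..} (tderiv f)"

definition C2 :: "(real \<Rightarrow> 'a::real_normed_vector) \<Rightarrow> bool" where
  "C2 f \<longleftrightarrow> f differentiable_on {0..} \<and> C1 (tderiv f)"

definition classical_solution ::
    "('a::complex_inner, 'a) op_graph \<Rightarrow> ('a, 'a) op_graph \<Rightarrow> (real \<Rightarrow> 'a) \<Rightarrow> bool" where
  "classical_solution R S u \<longleftrightarrow>
     C2 u \<and>
     (\<forall>t\<ge>0. u t \<in> Domain S) \<and> continuous_on {0..} (\<lambda>t. app S (u t)) \<and>
     (\<forall>t\<ge>0. tderiv u t \<in> Domain R) \<and> continuous_on {0..} (\<lambda>t. app R (tderiv u t)) \<and>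
     (\<forall>t\<ge>0. tderiv (tderiv u) t + app R (tderiv u t) + app S (u t) = 0)"

end

theory Submission
  imports Defs
begin

text \<open>
  Write \<open>T = |A|\<close>, \<open>v = B u'\<close> and \<open>w = B T u = T B u\<close>. As \<open>dom T = dom A\<close> with \<open>\<parallel>T x\<parallel> = \<parallel>A x\<parallel>\<close>,
  the energy is \<open>\<parallel>v\<parallel>\<^sup>2 + \<parallel>w\<parallel>\<^sup>2\<close>. Differentiability of \<open>T u\<close> is not known, so \<open>w'\<close> is computed
  through \<open>B u\<close>: closedness of \<open>B\<close> gives \<open>(B u)' = v\<close> and \<open>B u'' = v'\<close>, and closedness of \<open>T\<close> gives
  \<open>w' = T v\<close>. The equation shows \<open>T\<^sup>2 u \<in> dom B\<close>, so the commutation hypothesis applied to \<open>T u\<close>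
  gives \<open>T w = B T\<^sup>2 u\<close>, whence \<open>(w, w') = (T w, v) = (B T\<^sup>2 u, v)\<close>, and inserting
  \<open>B T\<^sup>2 u = - v' - B R u'\<close> cancels all terms but \<open>- 2 Re (v, B R u')\<close>.

  The operator \<open>|A|\<close> is a choice of square root, so its existence has to be proved. Bounded square
  roots come from the binomial series of \<open>(1 - X)\<^sup>1\<^sup>/\<^sup>2\<close>, whose coefficients are absolutely summable.
  A complex-linear operator has the same adjoint for the real inner product, hence most of the
  argument takes place in real Hilbert spaces.
\<close>

subsection \<open>Orthogonal projections and adjoints in real Hilbert spaces\<close>

lemma subspace_closure:
  fixes M :: "'a::real_normed_vector set"
  assumes "subspace M"
  shows "subspace (closure M)"
proof (rule subspaceI)
  show "0 \<in> closure M" using assms closure_subset subspace_0 by blast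
  show "x + y \<in> closure M" if xy: "x \<in> closure M" "y \<in> closure M" for x y
  proof -
    obtain f g where "\<forall>n. f n \<in> M" "f \<longlonglongrightarrow> x" "\<forall>n. g n \<in> M" "g \<longlonglongrightarrow> y"
      using xy unfolding closure_sequential by blast
    then show ?thesis using assms unfolding closure_sequential
      by (intro exI[of _ "\<lambda>n. f n + g n"]) (auto intro: tendsto_add subspace_add)
  qed
  show "c *\<^sub>R x \<in> closure M" if x: "x \<in> closure M" for c x
  proof -
    obtain f where "\<And>n. f n \<in> M" "f \<longlonglongrightarrow> x"
      using x unfolding closure_sequential by blast
    then show ?thesis using assms unfolding closure_sequential
      by (intro exI[of _ "\<lambda>n. c *\<^sub>R f n"]) (auto intro: tendsto_scaleR subspace_scale)
  qed
qed

text \<open>A minimizing sequence for the distance from \<open>x\<close> to \<open>M\<close> is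
  Cauchy by the parallelogram law. Its limit attains the distance, and minimality along each line
  through it forces orthogonality.\<close>

lemma orthogonal_projection_exists:
  fixes M :: "'a::{real_inner,banach} set"
  assumes M: "subspace M" "closed M"
  obtains m where "m \<in> M" "\<And>n. n \<in> M \<Longrightarrow> (x - m) \<bullet> n = 0"
proof -
  define d where "d = infdist x M"
  have ne: "M \<noteq> {}" using M subspace_0 by auto
  have d0: "0 \<le> d" by (simp add: d_def infdist_nonneg)
  have d_le: "d\<^sup>2 \<le> (norm (x - m))\<^sup>2" if "m \<in> M" for m
    using infdist_le[OF that, of x] d0 by (simp add: d_def dist_norm power_mono)
  have "\<exists>m\<in>M. (norm (x - m))\<^sup>2 < d\<^sup>2 + e" if "0 < e" for e
  proof -
    have "d < sqrt (d\<^sup>2 + e)" using that d0 by (simp add: real_less_rsqrt)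
    then have "Inf (dist x ` M) < sqrt (d\<^sup>2 + e)" by (simp add: d_def infdist_def ne)
    then obtain m where "m \<in> M" "dist x m < sqrt (d\<^sup>2 + e)"
      using ne by (subst (asm) cInf_less_iff) (auto intro: bdd_belowI2[where m=0])
    moreover from this have "(dist x m)\<^sup>2 < (sqrt (d\<^sup>2 + e))\<^sup>2"
      by (intro power_strict_mono) auto
    ultimately show ?thesis using that by (auto simp: dist_norm intro!: bexI[of _ m])
  qed
  moreover define r where "r n = inverse (real (Suc n))" for n
  ultimately have "\<forall>n. \<exists>m\<in>M. (norm (x - m))\<^sup>2 < d\<^sup>2 + r n"
    by simp
  then obtain m where m: "\<And>n. m n \<in> M"
    and md: "\<And>n. (norm (x - m n))\<^sup>2 < d\<^sup>2 + r n"
    by metis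
  \<comment> \<open>Parallelogram law for \<open>x - p\<close> and \<open>x - q\<close>: the
    midpoint of \<open>p\<close> and \<open>q\<close> lies in \<open>M\<close>, so its distance to
    \<open>x\<close> is at least \<open>d\<close>.\<close>
  have par: "(norm (p - q))\<^sup>2 \<le> 2 * ((norm (x - p))\<^sup>2 - d\<^sup>2) + 2 * ((norm (x - q))\<^sup>2 - d\<^sup>2)"
    if "p \<in> M" "q \<in> M" for p q
  proof -
    have "(1/2) *\<^sub>R (p + q) \<in> M" using that M by (simp add: subspace_add subspace_scale)
    from d_le[OF this] show ?thesis
      by (simp add: power2_norm_eq_inner algebra_simps inner_commute)
  qed
  have "Cauchy m"
  proof (rule metric_CauchyI)
    fix e :: real assume "0 < e"
    \<comment> \<open>By \<open>par\<close> the squared distance of \<open>m i\<close> and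
      \<open>m j\<close> is below \<open>2 * r i + 2 * r j\<close>, which is at most
      \<open>4 * r N\<close>.\<close>
    obtain N where N: "r N < e\<^sup>2 / 4"
      using reals_Archimedean[of "e\<^sup>2/4"] \<open>0 < e\<close> by (auto simp: r_def)
    have "dist (m i) (m j) < e" if "N \<le> i" "N \<le> j" for i j
    proof -
      have "r i \<le> r N" "r j \<le> r N"
        using that by (auto simp: r_def intro!: le_imp_inverse_le)
      moreover have "(norm (x - m i))\<^sup>2 - d\<^sup>2 < r i" "(norm (x - m j))\<^sup>2 - d\<^sup>2 < r j"
        using md[of i] md[of j] by simp_all
      ultimately have "(norm (m i - m j))\<^sup>2 < 4 * r N"
        using par[OF m[of i] m[of j]] by (smt (verit))
      then have "(norm (m i - m j))\<^sup>2 < e\<^sup>2" using N by simp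
      then show ?thesis using \<open>0 < e\<close> by (simp add: dist_norm power_less_imp_less_base)
    qed
    then show "\<exists>N. \<forall>i\<ge>N. \<forall>j\<ge>N. dist (m i) (m j) < e" by blast
  qed
  then obtain p where p: "m \<longlonglongrightarrow> p" using Cauchy_convergent convergent_def by blast
  have pM: "p \<in> M" using M(2) m p closed_sequentially by blast
  have "(norm (x - p))\<^sup>2 \<le> d\<^sup>2 + 0"
  proof (rule LIMSEQ_le)
    show "(\<lambda>n. (norm (x - m n))\<^sup>2) \<longlonglongrightarrow> (norm (x - p))\<^sup>2" by (intro tendsto_intros p)
    show "(\<lambda>n. d\<^sup>2 + r n) \<longlonglongrightarrow> d\<^sup>2 + 0"
      unfolding r_def
      by (intro tendsto_intros LIMSEQ_inverse_real_of_nat)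
  qed (use md less_imp_le in blast)
  then have min: "(norm (x - p))\<^sup>2 \<le> (norm (x - q))\<^sup>2" if "q \<in> M" for q
    using d_le[OF that] by linarith
  have "(x - p) \<bullet> n = 0" if n: "n \<in> M" for n
  proof (cases "n = 0")
    case False
    \<comment> \<open>The minimizer over real \<open>s\<close> of the squared norm of
      \<open>x - p - s n\<close>.\<close>
    define s where "s = ((x - p) \<bullet> n) / (n \<bullet> n)"
    have "p + s *\<^sub>R n \<in> M" using n pM M by (simp add: subspace_add subspace_scale)
    from min[OF this] have "2 * s * ((x - p) \<bullet> n) \<le> s * s * (n \<bullet> n)"
      by (simp add: power2_norm_eq_inner algebra_simps inner_commute)
    also have "s * s * (n \<bullet> n) = s * ((x - p) \<bullet> n)" using False by (simp add: s_def)
    finally have "s * ((x - p) \<bullet> n) \<le> 0" by simp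
    then have "((x - p) \<bullet> n)\<^sup>2 / (n \<bullet> n) \<le> 0" by (simp add: s_def power2_eq_square)
    then show ?thesis using False
      by (smt (verit) divide_pos_pos inner_gt_zero_iff zero_less_power2)
  qed simp
  then show thesis using that pM by blast
qed

text \<open>Project a point of \<open>N\<close> onto the closure of \<open>M\<close>. The remainder
  stays in \<open>N\<close> because that closure lies in \<open>N\<close>, and it is orthogonal to
  \<open>M\<close>.\<close>

lemma dense_if_orthogonal_trivial:
  fixes M N :: "'a::{real_inner,banach} set"
  assumes "subspace M" "subspace N" "closed N" "M \<subseteq> N"
    and triv: "\<And>x. x \<in> N \<Longrightarrow> (\<And>m. m \<in> M \<Longrightarrow> x \<bullet> m = 0) \<Longrightarrow> x = 0"
  shows "N \<subseteq> closure M"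
proof
  fix x assume x: "x \<in> N"
  obtain m where m: "m \<in> closure M" "\<And>n. n \<in> closure M \<Longrightarrow> (x - m) \<bullet> n = 0"
    using orthogonal_projection_exists[of "closure M" x] assms(1)
    by (metis closed_closure subspace_closure)
  have "closure M \<subseteq> N" using assms by (simp add: closure_minimal)
  then have "x - m \<in> N" using assms(2) x m(1) by (auto intro: subspace_diff)
  then have "x - m = 0" using triv m(2) closure_subset by blast
  then show "x \<in> closure M" using m(1) by simp
qed

text \<open>Reduces membership in a closed graph to scalar identities, so that curves in a graph can
  be handled by real-valued calculus.\<close>

lemma mem_subspace_if_orthogonal_orthogonal:
  fixes M :: "'a::{real_inner,banach} set"
  assumes "subspace M" "closed M" and "\<And>z. (\<And>m. m \<in> M \<Longrightarrow> z \<bullet> m = 0) \<Longrightarrow> z \<bullet> x = 0"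
  shows "x \<in> M"
proof -
  obtain m where m: "m \<in> M" "\<And>n. n \<in> M \<Longrightarrow> (x - m) \<bullet> n = 0"
    using orthogonal_projection_exists assms by metis
  then have "(x - m) \<bullet> (x - m) = 0" using assms(3)[of "x - m"] by (simp add: inner_diff_right)
  then show ?thesis using m by simp
qed

text \<open>As a relation this makes sense for every graph, dense domain or not, so its linearity
  and closedness come without assumptions on \<open>A\<close>.\<close>

definition real_adjoint :: "('a::real_inner \<times> 'b::real_inner) set \<Rightarrow> ('b \<times> 'a) set" where
  "real_adjoint A = {(y, z). \<forall>(x, w) \<in> A. w \<bullet> y = x \<bullet> z}"

lemma real_adjointD: "(y, z) \<in> real_adjoint A \<Longrightarrow> (x, w) \<in> A \<Longrightarrow> w \<bullet> y = x \<bullet> z"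
  by (auto simp: real_adjoint_def)

lemma subspace_real_adjoint: "subspace (real_adjoint A)"
  by (auto simp: real_adjoint_def subspace_def inner_add_right case_prod_beta)

lemma closed_real_adjoint: "closed (real_adjoint A)"
proof -
  have "real_adjoint A = (\<Inter>p\<in>A. {q. snd p \<bullet> fst q = fst p \<bullet> snd q})"
    by (auto simp: real_adjoint_def) force
  also have "closed \<dots>"
    by (intro closed_INT ballI closed_Collect_eq continuous_intros)
  finally show ?thesis .
qed

lemma subspace_Domain: "subspace A \<Longrightarrow> subspace (Domain A)"
  using linear_subspace_image[OF linear_fst, of A] by (simp add: Domain_fst)

lemma subspace_relcomp:
  assumes "subspace A" "subspace B"
  shows "subspace (A O B)"
proof (rule subspaceI)
  show "0 \<in> A O B" using assms[THEN subspace_0] by (auto simp: zero_prod_def)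
  fix p q assume "p \<in> A O B" "q \<in> A O B"
  then obtain x y z x' y' z' where
    p: "p = (x, z)" "(x, y) \<in> A" "(y, z) \<in> B" and
    q: "q = (x', z')" "(x', y') \<in> A" "(y', z') \<in> B" by (elim relcompE)
  from subspace_add[OF assms(1) p(2) q(2)] subspace_add[OF assms(2) p(3) q(3)]
  show "p + q \<in> A O B" by (auto simp: p(1) q(1))
next
  fix c p assume "p \<in> A O B"
  then obtain x y z where p: "p = (x, z)" "(x, y) \<in> A" "(y, z) \<in> B" by (elim relcompE)
  from subspace_scale[OF assms(1) p(2), of c] subspace_scale[OF assms(2) p(3), of c]
  show "c *\<^sub>R p \<in> A O B" by (auto simp: p(1))
qed

lemma single_valued_subspaceD: "single_valued A \<Longrightarrow> subspace A \<Longrightarrow> (0, y) \<in> A \<Longrightarrow> y = 0"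
  using subspace_0[of A] by (auto simp: zero_prod_def single_valued_def)

text \<open>
  Von Neumann: decompose \<open>(x, 0)\<close> into a vector of the graph of \<open>A\<close> and one orthogonal to it.
\<close>

lemma one_plus_adjoint_comp_surj:
  fixes A :: "('a::{real_inner,banach} \<times> 'b::{real_inner,banach}) set"
  assumes "subspace A" "closed A"
  obtains p q where "(p, q) \<in> A" "(q, x - p) \<in> real_adjoint A"
proof -
  obtain m where m: "m \<in> A" "\<And>n. n \<in> A \<Longrightarrow> ((x, 0) - m) \<bullet> n = 0"
    using orthogonal_projection_exists[OF assms] by metis
  obtain p q where pq: "m = (p, q)" by fastforce
  have "b \<bullet> q = a \<bullet> (x - p)" if "(a, b) \<in> A" for a b
    using m(2)[OF that] pq by (simp add: inner_commute)
  then have "(q, x - p) \<in> real_adjoint A" by (auto simp: real_adjoint_def)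
  then show thesis using that m pq by blast
qed

text \<open>Pairing \<open>s\<close> with \<open>x\<close> gives the squared norm of the
  intermediate vector \<open>q\<close>, while \<open>s = - x\<close> gives minus that of
  \<open>x\<close>; both vanish.\<close>

lemma one_plus_adjoint_comp_inj:
  assumes "(x, s) \<in> A O real_adjoint A" "x + s = 0"
  shows "x = 0" "s = 0"
proof -
  obtain q where q: "(x, q) \<in> A" "(q, s) \<in> real_adjoint A" using assms(1) by auto
  have "q \<bullet> q = x \<bullet> s" using q real_adjointD by blast
  moreover have "s = - x" using assms(2) by (metis add.inverse_unique)
  ultimately have "q \<bullet> q + x \<bullet> x = 0" by simp
  then show "x = 0" using inner_ge_zero[of q] inner_ge_zero[of x] by (metis add_nonneg_eq_0_iff inner_eq_zero_iff)
  then show "s = 0" using assms(2) by simp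
qed

text \<open>Let \<open>(a, b)\<close> in the graph be orthogonal to the restriction. Solving
  \<open>p + s = a\<close> with \<open>s\<close> the value of the product at \<open>p\<close> gives
  \<open>(p, q)\<close> in the restriction, and orthogonality to it collapses to
  \<open>a \<bullet> a = 0\<close>.\<close>

lemma graph_restricted_to_adjoint_comp_dense:
  fixes A :: "('a::{real_inner,banach} \<times> 'b::{real_inner,banach}) set"
  assumes A: "subspace A" "closed A" and "single_valued A"
  shows "A \<subseteq> closure {(x, y) \<in> A. x \<in> Domain (A O real_adjoint A)}" (is "_ \<subseteq> closure ?M")
proof (rule dense_if_orthogonal_trivial)
  have D: "subspace (Domain (A O real_adjoint A))"
    by (simp add: A subspace_Domain subspace_relcomp subspace_real_adjoint)
  show "subspace ?M"
  proof (rule subspaceI)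
    show "0 \<in> ?M" using subspace_0[OF A(1)] subspace_0[OF D] by (simp add: zero_prod_def)
    show "p + q \<in> ?M" if "p \<in> ?M" "q \<in> ?M" for p q
      using that subspace_add[OF A(1), of p q] subspace_add[OF D, of "fst p" "fst q"]
      by (cases p; cases q) auto
    show "c *\<^sub>R p \<in> ?M" if "p \<in> ?M" for c p
      using that subspace_scale[OF A(1), of p c] subspace_scale[OF D, of "fst p" c]
      by (cases p) auto
  qed
  fix z assume z: "z \<in> A" and orth: "\<And>m. m \<in> ?M \<Longrightarrow> z \<bullet> m = 0"
  obtain a b where ab: "z = (a, b)" by fastforce
  obtain p q where pq: "(p, q) \<in> A" "(q, a - p) \<in> real_adjoint A"
    using one_plus_adjoint_comp_surj A by metis
  then have "a \<bullet> p + b \<bullet> q = 0" using orth[of "(p, q)"] ab by auto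
  moreover have "b \<bullet> q = a \<bullet> (a - p)" using pq z ab real_adjointD by blast
  ultimately have "a = 0" by (simp add: inner_diff_right)
  then show "z = 0" using single_valued_subspaceD[OF assms(3) A(1)] z ab by (auto simp: zero_prod_def)
qed (use A in auto)

subsection \<open>Square roots of bounded operators\<close>

text \<open>The Taylor coefficients at 0 of the square root of 1 - x.\<close>

definition sqrt_coeff :: "nat \<Rightarrow> real" where
  "sqrt_coeff n = (- 1) ^ n * (1 / 2 gchoose n)"

lemma sqrt_coeff_0 [simp]: "sqrt_coeff 0 = 1"
  by (simp add: sqrt_coeff_def)

lemma alternating_gbinomial_pochhammer:
  "(- 1) ^ n * (a gchoose n) = pochhammer (- a) n / fact n" for a :: real
  by (simp add: gbinomial_pochhammer flip: power_mult_distrib)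

lemma sqrt_coeff_Suc_nonpos: "sqrt_coeff (Suc n) \<le> 0"
proof -
  have "0 \<le> pochhammer (1 / 2 :: real) n" by (rule pochhammer_nonneg) simp
  then show ?thesis
    unfolding sqrt_coeff_def alternating_gbinomial_pochhammer
    by (simp add: pochhammer_rec divide_nonpos_pos)
qed

text \<open>All coefficients after the first are nonpositive, so the absolute sum is 1 minus a
  partial sum of the series. That partial sum has a closed form, visibly nonnegative when written as
  a Pochhammer symbol.\<close>

lemma sum_abs_sqrt_coeff_le: "(\<Sum>n<N. \<bar>sqrt_coeff (Suc n)\<bar>) \<le> 1"
proof -
  have "0 \<le> pochhammer (1 / 2 :: real) N" by (rule pochhammer_nonneg) simp
  then have "0 \<le> (- 1) ^ N * ((1 / 2 - 1 :: real) gchoose N)"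
    unfolding alternating_gbinomial_pochhammer by simp
  also have "\<dots> = (\<Sum>n\<le>N. sqrt_coeff n)"
    by (simp only: gbinomial_sum_lower_neg[symmetric] sqrt_coeff_def mult.commute)
  also have "\<dots> = 1 - (\<Sum>n<N. \<bar>sqrt_coeff (Suc n)\<bar>)"
    using sqrt_coeff_Suc_nonpos
    by (simp add: sum.atMost_shift abs_of_nonpos sum_negf)
  finally show ?thesis by simp
qed

lemma summable_abs_sqrt_coeff: "summable (\<lambda>n. \<bar>sqrt_coeff n\<bar>)"
proof -
  have "summable (\<lambda>n. \<bar>sqrt_coeff (Suc n)\<bar>)"
    by (rule summableI_nonneg_bounded[OF _ sum_abs_sqrt_coeff_le]) simp
  then show ?thesis by (subst (asm) summable_Suc_iff)
qed

lemma suminf_abs_sqrt_coeff_le: "(\<Sum>n. \<bar>sqrt_coeff (Suc n)\<bar>) \<le> 1"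
  using summable_abs_sqrt_coeff sum_abs_sqrt_coeff_le
  by (intro suminf_le_const) (auto simp: summable_Suc_iff[of "\<lambda>n. \<bar>sqrt_coeff n\<bar>"])

text \<open>The Cauchy square of the series is 1 - x, by Vandermonde's identity for 1/2 + 1/2 =
  1.\<close>

lemma sqrt_coeff_convolution:
  "(\<Sum>i\<le>k. sqrt_coeff i * sqrt_coeff (k - i)) = (if k = 0 then 1 else if k = 1 then - 1 else 0)"
proof -
  have "(\<Sum>i\<le>k. sqrt_coeff i * sqrt_coeff (k - i)) =
      (\<Sum>i\<le>k. (- 1) ^ k * ((1 / 2 gchoose i) * (1 / 2 gchoose (k - i))))"
    by (rule sum.cong) (auto simp: sqrt_coeff_def simp flip: power_add)
  also have "\<dots> = (- 1) ^ k * (1 gchoose k)"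
    using gbinomial_Vandermonde[of "1 / 2 :: real" "1 / 2" k]
    by (simp add: atMost_atLeast0 flip: sum_distrib_left)
  also have "(1 :: real) gchoose k = real (1 choose k)"
    by (simp add: binomial_gbinomial)
  finally show ?thesis by (cases k rule: nat.exhaust) (auto simp: binomial_eq_0 not_less_eq)
qed

text \<open>Powers of a contraction stay bounded by 1, so summability of the coefficients suffices
  for convergence even when 1 - X is not invertible.\<close>

locale selfadjoint_contraction =
  fixes X :: "'a::{real_inner,banach} \<Rightarrow> 'a"
  assumes linear: "linear X"
    and norm_le: "norm (X x) \<le> norm x"
    and symmetric: "X x \<bullet> y = x \<bullet> X y"
begin

definition sqrt_one_minus :: "'a \<Rightarrow> 'a" where
  "sqrt_one_minus x = (\<Sum>n. sqrt_coeff n *\<^sub>R (X ^^ n) x)"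

lemma linear_funpow: "linear (X ^^ n)"
proof (induction n)
  case (Suc n)
  then show ?case using linear_compose[OF _ linear, of "X ^^ n"] by (simp add: o_def)
qed (simp add: id_def[symmetric] linear_id)

lemma norm_funpow_le: "norm ((X ^^ n) x) \<le> norm x"
  by (induction n) (auto intro: order_trans norm_le)

lemma symmetric_funpow: "(X ^^ n) x \<bullet> y = x \<bullet> (X ^^ n) y"
proof (induction n arbitrary: y)
  case (Suc n)
  have "(X ^^ Suc n) x \<bullet> y = (X ^^ n) x \<bullet> X y" by (simp add: symmetric)
  also have "\<dots> = x \<bullet> (X ^^ Suc n) y" by (simp add: Suc funpow_swap1)
  finally show ?case .
qed simp

lemma norm_term_le: "norm (sqrt_coeff n *\<^sub>R (X ^^ n) x) \<le> \<bar>sqrt_coeff n\<bar> * norm x"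
  by (simp add: mult_left_mono norm_funpow_le)

lemma summable_norm_terms: "summable (\<lambda>n. norm (sqrt_coeff n *\<^sub>R (X ^^ n) x))"
  by (rule summable_comparison_test[OF _ summable_mult2[OF summable_abs_sqrt_coeff, of "norm x"]])
     (auto intro!: exI[of _ 0] mult_left_mono norm_funpow_le)

lemma summable_terms: "summable (\<lambda>n. sqrt_coeff n *\<^sub>R (X ^^ n) x)"
  by (rule summable_norm_cancel[OF summable_norm_terms])

lemma linear_sqrt_one_minus: "linear sqrt_one_minus"
proof (rule linearI)
  show "sqrt_one_minus (x + y) = sqrt_one_minus x + sqrt_one_minus y" for x y
    unfolding sqrt_one_minus_def
    by (simp add: suminf_add[OF summable_terms summable_terms] linear_add[OF linear_funpow]
        scaleR_add_right)
  show "sqrt_one_minus (r *\<^sub>R x) = r *\<^sub>R sqrt_one_minus x" for r x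
    unfolding sqrt_one_minus_def
    by (simp add: suminf_scaleR_right[OF summable_terms] linear_scale[OF linear_funpow] mult.commute)
qed

text \<open>The coefficients after the leading 1 have total mass at most 1. The bound yields
  nonnegativity of the root, and it makes 1 minus the root a contraction, so that roots can be
  iterated.\<close>

lemma norm_diff_sqrt_one_minus_le: "norm (x - sqrt_one_minus x) \<le> norm x"
proof -
  let ?f = "\<lambda>n. sqrt_coeff (Suc n) *\<^sub>R (X ^^ Suc n) x"
  have sm: "summable (\<lambda>n. \<bar>sqrt_coeff (Suc n)\<bar> * norm x)"
    using summable_abs_sqrt_coeff by (subst (asm) summable_Suc_iff[symmetric]) (rule summable_mult2)
  have "sqrt_one_minus x = x + suminf ?f"
    unfolding sqrt_one_minus_def using suminf_split_head[OF summable_terms[of x]] by simp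
  then have "norm (x - sqrt_one_minus x) = norm (suminf ?f)" by simp
  also have "\<dots> \<le> (\<Sum>n. \<bar>sqrt_coeff (Suc n)\<bar> * norm x)"
    by (rule summable_norm[THEN order_trans])
       (use sm summable_norm_terms[of x] norm_term_le in
         \<open>auto simp del: funpow.simps norm_scaleR intro!: suminf_le
            simp: summable_Suc_iff[of "\<lambda>n. norm (sqrt_coeff n *\<^sub>R (X ^^ n) x)"]\<close>)
  also have "\<dots> \<le> 1 * norm x"
    using suminf_abs_sqrt_coeff_le summable_abs_sqrt_coeff
    by (subst suminf_mult2[symmetric]) 
       (auto simp: summable_Suc_iff[of "\<lambda>n. \<bar>sqrt_coeff n\<bar>"] intro!: mult_left_le_one_le suminf_nonneg)
  finally show ?thesis by simp
qed

lemma symmetric_sqrt_one_minus: "sqrt_one_minus x \<bullet> y = x \<bullet> sqrt_one_minus y"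
proof -
  have "sqrt_one_minus x \<bullet> y = (\<Sum>n. (sqrt_coeff n *\<^sub>R (X ^^ n) x) \<bullet> y)"
    unfolding sqrt_one_minus_def
    by (rule bounded_linear.suminf[OF bounded_linear_inner_left summable_terms])
  also have "\<dots> = (\<Sum>n. x \<bullet> (sqrt_coeff n *\<^sub>R (X ^^ n) y))"
    by (simp add: symmetric_funpow)
  also have "\<dots> = x \<bullet> sqrt_one_minus y"
    unfolding sqrt_one_minus_def
    by (rule bounded_linear.suminf[OF bounded_linear_inner_right summable_terms, symmetric])
  finally show ?thesis .
qed

lemma sqrt_one_minus_nonneg: "0 \<le> sqrt_one_minus x \<bullet> x"
proof -
  have "(x - sqrt_one_minus x) \<bullet> x \<le> norm (x - sqrt_one_minus x) * norm x"
    by (rule norm_cauchy_schwarz)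
  also have "\<dots> \<le> norm x * norm x"
    by (intro mult_right_mono norm_diff_sqrt_one_minus_le) simp
  also have "\<dots> = x \<bullet> x" by (simp add: norm_eq_sqrt_inner)
  finally show ?thesis by (simp add: inner_diff_left)
qed

text \<open>\<open>M\<close> commutes with every power of \<open>X\<close> and passes through the
  limit. Taking a complex scalar multiplication for \<open>M\<close> later yields complex linearity
  of the roots.\<close>

lemma sqrt_one_minus_commute:
  assumes M: "bounded_linear M" and comm: "\<And>x. M (X x) = X (M x)"
  shows "M (sqrt_one_minus x) = sqrt_one_minus (M x)"
proof -
  have "M ((X ^^ n) y) = (X ^^ n) (M y)" for n y
    by (induction n) (auto simp: comm)
  then show ?thesis
    unfolding sqrt_one_minus_def bounded_linear.suminf[OF M summable_terms]
    by (simp add: linear_scale[OF bounded_linear.linear[OF M]])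
qed

lemma bounded_linear_sqrt_one_minus: "bounded_linear sqrt_one_minus"
proof (rule bounded_linear_intro[of _ 2])
  show "norm (sqrt_one_minus x) \<le> norm x * 2" for x
    using norm_diff_sqrt_one_minus_le[of x] norm_triangle_ineq2[of "sqrt_one_minus x" x]
    by (simp add: norm_minus_commute)
qed (simp_all add: linear_sqrt_one_minus linear_add linear_scale)

lemma bounded_linear_funpow: "bounded_linear (X ^^ n)"
  by (rule bounded_linear_intro[of _ 1])
     (simp_all add: linear_add linear_scale linear_funpow norm_funpow_le)

text \<open>The double family \<open>f\<close> is summed in two ways: by rows it gives the iterated
  root, along the antidiagonals it gives the convolution of the coefficients.\<close>

lemma sqrt_one_minus_square: "sqrt_one_minus (sqrt_one_minus x) = x - X x"
proof -
  define f where "f = (\<lambda>(m, n). (sqrt_coeff m * sqrt_coeff n) *\<^sub>R (X ^^ (m + n)) x)"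
  have hs: "((\<lambda>n. sqrt_coeff n *\<^sub>R (X ^^ n) y) has_sum sqrt_one_minus y) UNIV" for y
    unfolding sqrt_one_minus_def
    by (intro norm_summable_imp_has_sum summable_norm_terms summable_sums summable_terms)
  have inner: "((\<lambda>n. f (m, n)) has_sum sqrt_coeff m *\<^sub>R (X ^^ m) (sqrt_one_minus x)) UNIV" for m
  proof -
    have "((\<lambda>n. sqrt_coeff m *\<^sub>R (X ^^ m) (sqrt_coeff n *\<^sub>R (X ^^ n) x)) has_sum
        sqrt_coeff m *\<^sub>R (X ^^ m) (sqrt_one_minus x)) UNIV"
      by (intro has_sum_scaleR has_sum_bounded_linear[OF bounded_linear_funpow] hs)
    then show ?thesis
      by (simp add: f_def linear_scale[OF linear_funpow] funpow_add)
  qed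
  have abs_sm: "(\<lambda>n. \<bar>sqrt_coeff n\<bar>) summable_on UNIV"
    using summable_abs_sqrt_coeff by (intro norm_summable_imp_summable_on) simp
  have "f summable_on UNIV \<times> UNIV"
  proof (rule abs_summable_summable)
    show "(\<lambda>p. norm (f p)) summable_on UNIV \<times> UNIV"
    \<comment> \<open>The contraction property removes the power of \<open>X\<close>, leaving a
      majorant that factors into \<open>m\<close> and \<open>n\<close>.\<close>
    proof (rule Infinite_Sum.abs_summable_on_comparison_test'[where g = "\<lambda>(m, n). \<bar>sqrt_coeff m\<bar> * (\<bar>sqrt_coeff n\<bar> * norm x)"])
      fix p :: "nat \<times> nat"
      show "norm (f p) \<le> (\<lambda>(m, n). \<bar>sqrt_coeff m\<bar> * (\<bar>sqrt_coeff n\<bar> * norm x)) p"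
        using norm_funpow_le[of "fst p + snd p" x]
        by (simp add: f_def case_prod_beta abs_mult mult.assoc mult_left_mono)
    next
      show "(\<lambda>(m, n). \<bar>sqrt_coeff m\<bar> * (\<bar>sqrt_coeff n\<bar> * norm x)) summable_on UNIV \<times> UNIV"
        by (rule summable_on_SigmaI[where g = "\<lambda>m. \<bar>sqrt_coeff m\<bar> * (infsum (\<lambda>n. \<bar>sqrt_coeff n\<bar>) UNIV * norm x)"])
          (use abs_sm in \<open>auto intro!: has_sum_cmult_right has_sum_cmult_left summable_on_cmult_left\<close>)
    qed
  qed
  then obtain S where S: "(f has_sum S) (UNIV \<times> UNIV)" by (auto simp: summable_on_def)
  have "((\<lambda>m. sqrt_coeff m *\<^sub>R (X ^^ m) (sqrt_one_minus x)) has_sum S) UNIV"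
    by (rule has_sum_SigmaD[OF S]) (use inner in auto)
  then have 1: "S = sqrt_one_minus (sqrt_one_minus x)" using hs has_sum_unique by blast
  \<comment> \<open>\<open>f\<close> reindexed by total degree \<open>k = m + n\<close>, with
    \<open>i = m\<close>.\<close>
  define g where "g = (\<lambda>(k, i). (sqrt_coeff i * sqrt_coeff (k - i)) *\<^sub>R (X ^^ k) x)"
  have "(f has_sum S) (UNIV \<times> UNIV) \<longleftrightarrow> (g has_sum S) (SIGMA k:UNIV. {..k})"
    by (rule has_sum_reindex_bij_witness[
          where i = "\<lambda>(k, i). (i, k - i)" and j = "\<lambda>(m, n). (m + n, m)"])
       (auto simp: f_def g_def)
  with S have gS: "(g has_sum S) (SIGMA k:UNIV. {..k})" by blast
  have row: "((\<lambda>i. g (k, i)) has_sum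
      (if k = 0 then x else if k = 1 then - X x else 0)) {..k}" for k
  proof -
    have "(\<Sum>i\<le>k. g (k, i)) = (\<Sum>i\<le>k. sqrt_coeff i * sqrt_coeff (k - i)) *\<^sub>R (X ^^ k) x"
      by (simp add: g_def scaleR_sum_left)
    also have "\<dots> = (if k = 0 then x else if k = 1 then - X x else 0)"
      by (subst sqrt_coeff_convolution) auto
    finally show ?thesis using has_sum_finite[of "{..k}" "\<lambda>i. g (k, i)"] by simp
  qed
  have "((\<lambda>k::nat. if k = 0 then x else if k = 1 then - X x else 0) has_sum S) UNIV"
    by (rule has_sum_SigmaD[OF gS row])
  moreover have "((\<lambda>k::nat. if k = 0 then x else if k = 1 then - X x else 0) has_sum x - X x) UNIV"
    by (rule has_sum_finite_neutralI[of "{0, 1}"]) auto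
  ultimately show ?thesis using 1 has_sum_unique by fastforce
qed

end

subsection \<open>The absolute value of a closed operator\<close>

instance complex_hilbert \<subseteq> banach ..

section \<open>Complex-linear operators viewed over the reals\<close>

lemma linear_operator_imp_subspace: "linear_operator A \<Longrightarrow> subspace A"
proof (rule subspaceI)
  assume A: "linear_operator A"
  show "0 \<in> A" using A by (simp add: linear_operator_def zero_prod_def)
  show "p + q \<in> A" if "p \<in> A" "q \<in> A" for p q
    using A that by (cases p; cases q) (auto simp: linear_operator_def)
  show "c *\<^sub>R p \<in> A" if "p \<in> A" for c p
  proof (cases p)
    case (Pair x y)
    then have "(complex_of_real c *\<^sub>C x, complex_of_real c *\<^sub>C y) \<in> A"
      using A that unfolding linear_operator_def by blast
    then show ?thesis using Pair by (simp add: scaleC_of_real)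
  qed
qed

lemma linear_operatorI:
  assumes "single_valued A" "subspace A"
    and "\<And>c x y. (x, y) \<in> A \<Longrightarrow> (c *\<^sub>C x, c *\<^sub>C y) \<in> A"
  shows "linear_operator A"
  using assms subspace_0[of A] subspace_add[of A "(_, _)" "(_, _)"]
  unfolding linear_operator_def by (auto simp: zero_prod_def)

lemma cinner_scaleC_left: "cinner (c *\<^sub>C x) y = cnj c * cinner x y"
  by (metis cinner_commute cinner_scaleC_right complex_cnj_mult)

lemma Im_cinner: "Im (cinner x y) = (\<i> *\<^sub>C x) \<bullet> y"
  by (simp add: inner_eq_Re_cinner cinner_scaleC_left)

text \<open>The real identity at \<open>\<i> *\<^sub>C x\<close> supplies the imaginary part of the
  complex one at \<open>x\<close>.\<close>

lemma adjoint_op_eq_real_adjoint: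
  assumes "linear_operator A"
  shows "adjoint_op A = real_adjoint A"
proof (intro equalityI subrelI)
  show "(y, z) \<in> real_adjoint A" if "(y, z) \<in> adjoint_op A" for y z
    using that by (auto simp: adjoint_op_def real_adjoint_def inner_eq_Re_cinner)
  fix y z assume yz: "(y, z) \<in> real_adjoint A"
  have "cinner w y = cinner x z" if "(x, w) \<in> A" for x w
  proof -
    have "(\<i> *\<^sub>C x, \<i> *\<^sub>C w) \<in> A" using assms that by (auto simp: linear_operator_def)
    from real_adjointD[OF yz this] real_adjointD[OF yz that] show ?thesis
      unfolding Im_cinner[symmetric] by (simp add: inner_eq_Re_cinner complex_eq_iff)
  qed
  then show "(y, z) \<in> adjoint_op A" by (auto simp: adjoint_op_def)
qed

lemma scaleC_adjoint_op:
  "(y, z) \<in> adjoint_op A \<Longrightarrow> (c *\<^sub>C y, c *\<^sub>C z) \<in> adjoint_op A"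
  by (auto simp: adjoint_op_def cinner_scaleC_right)

lemma norm_scaleC: "norm (c *\<^sub>C x) = norm c * norm x"
proof -
  have "(c *\<^sub>C x) \<bullet> (c *\<^sub>C x) = Re ((c * cnj c) * cinner x x)"
    by (simp only: inner_eq_Re_cinner cinner_scaleC_left cinner_scaleC_right ac_simps)
  also have "\<dots> = (norm c)\<^sup>2 * (x \<bullet> x)"
    by (simp add: complex_norm_square[symmetric] inner_eq_Re_cinner)
  finally show ?thesis by (simp add: norm_eq_sqrt_inner real_sqrt_mult)
qed

lemma bounded_linear_scaleC: "bounded_linear (\<lambda>x. c *\<^sub>C x)"
proof (rule bounded_linear_intro[of _ "norm c"])
  show "c *\<^sub>C (r *\<^sub>R x) = r *\<^sub>R c *\<^sub>C x" for r x
    by (simp add: scaleC_scaleC mult.commute flip: scaleC_of_real)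
qed (simp_all add: scaleC_add_right norm_scaleC mult.commute)

lemma orthogonal_to_dense:
  assumes "closure D = UNIV" and "\<And>d. d \<in> D \<Longrightarrow> x \<bullet> d = 0"
  shows "x = 0"
proof -
  have "D \<subseteq> {d. x \<bullet> d = 0}" using assms(2) by auto
  moreover have "closed {d. x \<bullet> d = 0}" by (intro closed_Collect_eq continuous_intros)
  ultimately have "closure D \<subseteq> {d. x \<bullet> d = 0}" by (rule closure_minimal)
  then show ?thesis using assms(1) inner_eq_zero_iff by blast
qed

text \<open>
  With the bounded resolvent \<open>J = (1 + A\<^sup>*A)\<^sup>-\<^sup>1\<close>, \<open>K = J\<^sup>1\<^sup>/\<^sup>2\<close> and \<open>L = (1 - J)\<^sup>1\<^sup>/\<^sup>2\<close>, the square root is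
  \<open>L K\<^sup>-\<^sup>1\<close>, with graph \<open>{(K x, L x)}\<close>. Since \<open>K\<^sup>2 + L\<^sup>2 = 1\<close>, this graph is
  also \<open>{(x, y). L x = K y}\<close>, which makes self-adjointness evident.
\<close>

lemma selfadjoint_sqrt_of_adjoint_comp_exists:
  fixes A :: "('a::complex_hilbert, 'b::complex_hilbert) op_graph"
  assumes A: "linear_operator A" "densely_defined A" "closed A"
  obtains T where "nonneg_selfadjoint T" "T \<odot> T = adjoint_op A \<odot> A"
proof -
  define S where "S = adjoint_op A \<odot> A"
  have sA: "subspace A" using A(1) by (rule linear_operator_imp_subspace)
  have adj: "adjoint_op A = real_adjoint A" using A(1) by (rule adjoint_op_eq_real_adjoint)
  have sS: "subspace S" unfolding S_def adj by (intro subspace_relcomp sA subspace_real_adjoint)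
  have S_scaleC: "(c *\<^sub>C x, c *\<^sub>C y) \<in> S" if "(x, y) \<in> S" for c x y
    using that A(1) unfolding S_def
    by (auto simp: linear_operator_def intro!: relcompI scaleC_adjoint_op)
  have inj: "x = x'" if "(x, s) \<in> S" "(x', s') \<in> S" "x + s = x' + s'" for x s x' s'
    using one_plus_adjoint_comp_inj[of "x - x'" "s - s'" A] subspace_diff[OF sS that(1,2)] that(3)
    by (auto simp: S_def adj algebra_simps)
  have "\<exists>p. (p, x - p) \<in> S" for x
    using one_plus_adjoint_comp_surj[OF sA A(3)] unfolding S_def adj by blast
  \<comment> \<open>\<open>J x\<close> is the solution \<open>p\<close> of \<open>p + s = x\<close>
    with \<open>(p, s)\<close> in \<open>S\<close>; by \<open>inj\<close> it is unique, which makes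
    \<open>J\<close> linear, also over the complex numbers.\<close>
  then obtain J where J: "\<And>x. (J x, x - J x) \<in> S" by metis
  have J_unique: "J (p + s) = p" if "(p, s) \<in> S" for p s
    by (rule inj[OF J that]) simp
  have "linear J"
  proof (rule linearI)
    show "J (x + y) = J x + J y" for x y
      using J_unique[of "J x + J y" "(x - J x) + (y - J y)"] subspace_add[OF sS J J, of x y] by simp
    show "J (r *\<^sub>R x) = r *\<^sub>R J x" for r x
      using J_unique[of "r *\<^sub>R J x" "r *\<^sub>R (x - J x)"] subspace_scale[OF sS J, of r x]
      by (simp add: algebra_simps)
  qed
  have J_scaleC: "J (c *\<^sub>C x) = c *\<^sub>C J x" for c x
    using J_unique[OF S_scaleC[OF J], of c x] by (simp flip: scaleC_add_right)
  have S_inner: "s \<bullet> x' = x \<bullet> s'" "0 \<le> s \<bullet> x" if xs: "(x, s) \<in> S" "(x', s') \<in> S" for x s x' s'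
  proof -
    obtain y y' where "(x, y) \<in> A" "(y, s) \<in> real_adjoint A" "(x', y') \<in> A" "(y', s') \<in> real_adjoint A"
      using xs unfolding S_def adj by blast
    then have "y' \<bullet> y = x' \<bullet> s" "y \<bullet> y' = x \<bullet> s'" "y \<bullet> y = x \<bullet> s"
      by (blast dest: real_adjointD)+
    then show "s \<bullet> x' = x \<bullet> s'" "0 \<le> s \<bullet> x" by (metis inner_commute inner_ge_zero)+
  qed
  have J_sym: "J x \<bullet> y = x \<bullet> J y" for x y
    using S_inner(1)[OF J J, of x y] by (simp add: inner_diff_left inner_diff_right)
  \<comment> \<open>Nonnegativity of \<open>S\<close> at \<open>J x\<close>; combined with
    \<open>cs\<close> below it makes \<open>J\<close> a contraction.\<close>
  have J_pos: "J x \<bullet> J x \<le> x \<bullet> J x" for x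
    using S_inner(2)[OF J J, of x] by (simp add: inner_diff_left)
  have norm_leI: "norm v \<le> norm w" if "v \<bullet> v \<le> w \<bullet> w" for v w :: 'a
    using that by (simp add: norm_eq_sqrt_inner)
  have cs: "2 * (x \<bullet> J x) \<le> x \<bullet> x + J x \<bullet> J x" for x
    using inner_ge_zero[of "x - J x"] by (simp add: inner_diff_left inner_diff_right inner_commute)
  interpret J: selfadjoint_contraction J
  proof (rule selfadjoint_contraction.intro)
    show "norm (J x) \<le> norm x" for x
      using J_pos[of x] cs[of x] by (intro norm_leI) linarith
  qed (rule \<open>linear J\<close> J_sym)+
  interpret J': selfadjoint_contraction "\<lambda>x. x - J x"
  proof (rule selfadjoint_contraction.intro)
    show "linear (\<lambda>x. x - J x)" using \<open>linear J\<close> by (intro linear_compose_sub linear_ident)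
    show "norm (x - J x) \<le> norm x" for x
    proof (rule norm_leI)
      have "0 \<le> x \<bullet> J x" using J_pos[of x] inner_ge_zero[of "J x"] by linarith
      then show "(x - J x) \<bullet> (x - J x) \<le> x \<bullet> x"
        using J_pos[of x] by (simp add: inner_diff_left inner_diff_right inner_commute)
    qed
    show "(x - J x) \<bullet> y = x \<bullet> (y - J y)" for x y
      by (simp add: inner_diff_left inner_diff_right J_sym)
  qed
  \<comment> \<open>The names cross over: \<open>J'\<close> is built on 1 - J, so its root is that
    of \<open>J\<close>, and \<open>J\<close> yields the root of 1 - J.\<close>
  define K where "K = J'.sqrt_one_minus"
  define L where "L = J.sqrt_one_minus"
  have KK: "K (K x) = J x" for x by (simp add: K_def J'.sqrt_one_minus_square)
  have LL: "L (L x) = x - J x" for x by (simp add: L_def J.sqrt_one_minus_square)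
  have bK: "bounded_linear K" and bL: "bounded_linear L" and lK: "linear K" and lL: "linear L"
    unfolding K_def L_def
    by (rule J'.bounded_linear_sqrt_one_minus J.bounded_linear_sqrt_one_minus
      J'.linear_sqrt_one_minus J.linear_sqrt_one_minus)+
  have K_sym: "K x \<bullet> y = x \<bullet> K y" and L_sym: "L x \<bullet> y = x \<bullet> L y" for x y
    by (simp_all add: K_def L_def J.symmetric_sqrt_one_minus J'.symmetric_sqrt_one_minus)
  have JK: "J (K x) = K (J x)" for x by (metis KK)
  have KL: "K (L x) = L (K x)" for x
    unfolding L_def by (rule J.sqrt_one_minus_commute[OF bK]) (simp add: JK)
  have K_scaleC: "K (c *\<^sub>C x) = c *\<^sub>C K x" for c x
    unfolding K_def
    by (rule J'.sqrt_one_minus_commute[OF bounded_linear_scaleC, symmetric])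
       (simp add: J_scaleC linear_diff[OF bounded_linear.linear[OF bounded_linear_scaleC]])
  have L_scaleC: "L (c *\<^sub>C x) = c *\<^sub>C L x" for c x
    unfolding L_def
    by (rule J.sqrt_one_minus_commute[OF bounded_linear_scaleC, symmetric]) (simp add: J_scaleC)
  \<comment> \<open>Nonnegativity of \<open>K L\<close> needs a square root \<open>M\<close> of one of the commuting factors.\<close>
  interpret L': selfadjoint_contraction "\<lambda>x. x - L x"
  proof (rule selfadjoint_contraction.intro)
    show "linear (\<lambda>x. x - L x)" using lL by (intro linear_compose_sub linear_ident)
    show "norm (x - L x) \<le> norm x" for x
      unfolding L_def by (rule J.norm_diff_sqrt_one_minus_le)
    show "(x - L x) \<bullet> y = x \<bullet> (y - L y)" for x y
      by (simp add: inner_diff_left inner_diff_right L_sym)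
  qed
  define M where "M = L'.sqrt_one_minus"
  have KL_nonneg: "0 \<le> K x \<bullet> L x" for x
  proof -
    have MM: "M (M x) = L x" for x by (simp add: M_def L'.sqrt_one_minus_square)
    have KM: "K (M x) = M (K x)" for x
      unfolding M_def by (rule L'.sqrt_one_minus_commute[OF bK]) (simp add: KL linear_diff[OF lK])
    have "K x \<bullet> L x = M (K x) \<bullet> M x"
      by (simp add: MM[symmetric]) (simp add: M_def L'.symmetric_sqrt_one_minus)
    also have "\<dots> = K (M x) \<bullet> M x" by (simp add: KM)
    finally show ?thesis by (simp add: K_def J'.sqrt_one_minus_nonneg)
  qed
  \<comment> \<open>If \<open>K x = 0\<close> then \<open>J x = 0\<close>, so \<open>(0, x)\<close>
    is in \<open>S\<close>, and \<open>x\<close> is orthogonal to the dense domain of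
    \<open>A\<close>.\<close>
  have K_eq_0D: "x = 0" if "K x = 0" for x
  proof -
    have "J x = 0" using that KK[of x] by (simp add: linear_0[OF lK])
    then have "(0, x) \<in> S" using J[of x] by simp
    then obtain y where y: "(0, y) \<in> A" "(y, x) \<in> real_adjoint A" unfolding S_def adj by blast
    have "y = 0" using y(1) A(1) sA single_valued_subspaceD by (auto simp: linear_operator_def)
    then have "x \<bullet> d = 0" if "d \<in> Domain A" for d
      using that real_adjointD[OF y(2)] by (auto simp: inner_commute)
    then show "x = 0" using orthogonal_to_dense A(2) unfolding densely_defined_def by blast
  qed
  define T where "T = range (\<lambda>x. (K x, L x))"
  have sT: "subspace T"
    unfolding T_def using lK lL
    by (intro linear_subspace_image subspace_UNIV) (auto simp: linear_iff)
  \<comment> \<open>If \<open>x = K p\<close> and \<open>y = L p\<close>, then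
    \<open>p = K (K p) + L (L p) = K x + L y\<close>; this fixes the witness.\<close>
  have TI: "(x, y) \<in> T" if "L x = K y" for x y
  proof -
    have "K (K x + L y) = J x + L (K y)" by (simp add: linear_add[OF lK] KK KL)
    then have "K (K x + L y) = x" by (simp add: LL flip: that)
    moreover have "L (K x + L y) = K (L x) + (y - J y)" by (simp add: linear_add[OF lL] LL KL)
    then have "L (K x + L y) = y" by (simp add: that KK)
    ultimately show ?thesis unfolding T_def by (intro range_eqI[of _ _ "K x + L y"]) simp
  qed
  have TD: "L x = K y" if "(x, y) \<in> T" for x y using that KL by (auto simp: T_def)
  have "linear_operator T"
  proof (rule linear_operatorI[OF _ sT])
    have "y = 0" if "(0, y) \<in> T" for y
      using TD[OF that] K_eq_0D by (simp add: linear_0[OF lL])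
    then show "single_valued T"
      using subspace_diff[OF sT] by (fastforce intro!: single_valuedI)
    show "(c *\<^sub>C x, c *\<^sub>C y) \<in> T" if "(x, y) \<in> T" for c x y
      using TD[OF that] by (intro TI) (simp add: K_scaleC L_scaleC)
  qed
  moreover have "densely_defined T"
  proof -
    have "UNIV \<subseteq> closure (Domain T)"
    proof (rule dense_if_orthogonal_trivial)
      fix x assume "\<And>m. m \<in> Domain T \<Longrightarrow> x \<bullet> m = 0"
      \<comment> \<open>Testing against \<open>K (K x)\<close> produces the squared norm of
        \<open>K x\<close>.\<close>
      then have "x \<bullet> K (K x) = 0" by (auto simp: T_def)
      then show "x = 0" using K_eq_0D K_sym[of x "K x"] by simp
    qed (auto intro: subspace_Domain sT)
    then show ?thesis by (auto simp: densely_defined_def)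
  qed
  moreover have "adjoint_op T = T"
    unfolding adjoint_op_eq_real_adjoint[OF \<open>linear_operator T\<close>]
  proof (intro equalityI subrelI)
    fix y z assume yz: "(y, z) \<in> real_adjoint T"
    have "(L y - K z) \<bullet> d = 0" for d
    proof -
      have "L d \<bullet> y = K d \<bullet> z" by (rule real_adjointD[OF yz]) (simp add: T_def)
      then have "d \<bullet> L y = d \<bullet> K z" by (simp add: K_sym L_sym)
      then show ?thesis by (subst inner_commute) (simp add: inner_diff_right)
    qed
    then have "L y - K z = 0" using inner_eq_zero_iff by blast
    then show "(y, z) \<in> T" by (intro TI) simp
  next
    fix y z assume "(y, z) \<in> T"
    then have "L y = K z" by (rule TD)
    then show "(y, z) \<in> real_adjoint T" by (auto simp: real_adjoint_def T_def K_sym L_sym)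
  qed
  moreover have "0 \<le> Re (cinner x y)" if "(x, y) \<in> T" for x y
    using that KL_nonneg by (auto simp: T_def inner_eq_Re_cinner)
  ultimately have nT: "nonneg_selfadjoint T" by (auto simp: nonneg_selfadjoint_def)
  have S_eq: "(x, s) \<in> S \<longleftrightarrow> (\<exists>p. x = J p \<and> s = p - J p)" for x s
  proof
    assume "(x, s) \<in> S"
    then show "\<exists>p. x = J p \<and> s = p - J p" using J_unique by (intro exI[of _ "x + s"]) simp
  qed (use J in auto)
  have "T \<odot> T = S"
  proof (intro equalityI subrelI)
    fix x z assume "(x, z) \<in> T \<odot> T"
    then obtain y w v where y: "x = K w" "y = L w" "y = K v" "z = L v" by (auto simp: T_def)
    \<comment> \<open>The shared middle vector says \<open>L w = K v\<close>, which is the criterion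
      \<open>TI\<close>; the resulting \<open>p\<close> gives \<open>x = J p\<close> and
      \<open>z = p - J p\<close>.\<close>
    have "(w, v) \<in> T" by (rule TI) (use y in simp)
    then obtain p where "w = K p" "v = L p" by (auto simp: T_def)
    then show "(x, z) \<in> S" using y KK[of p] LL[of p] by (auto simp: S_eq)
  next
    fix x z assume "(x, z) \<in> S"
    then obtain p where p: "x = K (K p)" "z = L (L p)" using KK LL by (auto simp: S_eq)
    have "(K (K p), L (K p)) \<in> T" "(K (L p), L (L p)) \<in> T" unfolding T_def by blast+
    then show "(x, z) \<in> T \<odot> T" unfolding p KL by (rule relcompI)
  qed
  then show thesis using that nT by (simp add: S_def)
qed

section \<open>Comparing an operator with its absolute value\<close>

lemma single_valued_linear_operator: "linear_operator A \<Longrightarrow> single_valued A"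
  by (simp add: linear_operator_def)

text \<open>
  The norms agree on the domain of the common product \<open>G\<^sup>*G = H\<^sup>*H\<close>, which is a core of both operators.
\<close>

lemma graph_transfer_same_adjoint_comp:
  fixes G :: "('a::{real_inner,banach} \<times> 'b::{real_inner,banach}) set"
    and H :: "('a \<times> 'c::{real_inner,banach}) set"
  assumes G: "subspace G" "closed G" "single_valued G"
    and H: "subspace H" "closed H" "single_valued H"
    and eq: "G O real_adjoint G = H O real_adjoint H"
    and xy: "(x, y) \<in> G"
  obtains z where "(x, z) \<in> H" "norm z = norm y"
proof -
  let ?D = "Domain (G O real_adjoint G)"
  \<comment> \<open>Both squared norms equal \<open>a \<bullet> s\<close>, where \<open>s\<close> is
    the value at \<open>a\<close> of the common product.\<close>
  have iso: "norm b = norm c" if "a \<in> ?D" "(a, b) \<in> G" "(a, c) \<in> H" for a b c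
  proof -
    obtain s where "(a, s) \<in> G O real_adjoint G" using \<open>a \<in> ?D\<close> by blast
    moreover from this have "(a, s) \<in> H O real_adjoint H" using eq by simp
    ultimately obtain b' c' where "(a, b') \<in> G" "(b', s) \<in> real_adjoint G"
      "(a, c') \<in> H" "(c', s) \<in> real_adjoint H" by blast
    then have "(b, s) \<in> real_adjoint G" "(c, s) \<in> real_adjoint H"
      using that G(3) H(3) by (auto dest: single_valuedD)
    then have "b \<bullet> b = a \<bullet> s" "c \<bullet> c = a \<bullet> s" using that by (auto dest: real_adjointD)
    then show ?thesis by (simp add: norm_eq_sqrt_inner)
  qed
  have D: "subspace ?D" by (intro subspace_Domain subspace_relcomp G subspace_real_adjoint)
  have "(x, y) \<in> closure {(x, y) \<in> G. x \<in> ?D}"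
    using graph_restricted_to_adjoint_comp_dense[OF G] xy by blast
  then obtain f where f: "\<And>n. f n \<in> {(x, y) \<in> G. x \<in> ?D}" "f \<longlonglongrightarrow> (x, y)"
    unfolding closure_sequential by blast
  have fG: "(fst (f n), snd (f n)) \<in> G" "fst (f n) \<in> ?D" for n
    using f(1)[of n] by (simp_all add: case_prod_beta)
  have "\<exists>c. (fst (f n), c) \<in> H" for n using fG(2)[of n] unfolding eq by blast
  then obtain h where h: "\<And>n. (fst (f n), h n) \<in> H" by metis
  \<comment> \<open>By linearity \<open>iso\<close> applies to differences, so convergence of the
    \<open>G\<close>-values makes the \<open>H\<close>-values Cauchy.\<close>
  have "dist (h m) (h n) = dist (snd (f m)) (snd (f n))" for m n
    using iso[OF subspace_diff[OF D fG(2) fG(2)] subspace_diff[OF G(1) fG(1) fG(1), unfolded diff_Pair]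
        subspace_diff[OF H(1) h h, unfolded diff_Pair], of m n]
    by (simp only: dist_norm)
  moreover have "Cauchy (\<lambda>n. snd (f n))"
    using tendsto_snd[OF f(2)] by (auto intro: convergent_Cauchy convergentI)
  ultimately have "Cauchy h" by (simp add: Cauchy_def)
  then obtain z where z: "h \<longlonglongrightarrow> z" using Cauchy_convergent convergent_def by blast
  have "(\<lambda>n. (fst (f n), h n)) \<longlonglongrightarrow> (x, z)"
    using tendsto_Pair[OF tendsto_fst[OF f(2)] z] by simp
  then have "(x, z) \<in> H" by (rule closed_sequentially[OF H(2) h])
  moreover have "(\<lambda>n. norm (h n)) \<longlonglongrightarrow> norm y"
    using tendsto_norm[OF tendsto_snd[OF f(2)]] iso[OF fG(2,1) h] by simp
  then have "norm z = norm y" using LIMSEQ_unique[OF tendsto_norm[OF z]] by blast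
  ultimately show thesis by (rule that)
qed

lemma abs_op_properties:
  fixes A :: "('a::complex_hilbert, 'b::complex_hilbert) op_graph"
  assumes A: "linear_operator A" "densely_defined A" "closed A"
  shows "nonneg_selfadjoint (abs_op A)" "abs_op A \<odot> abs_op A = adjoint_op A \<odot> A"
proof -
  have "\<exists>T. nonneg_selfadjoint T \<and> T \<odot> T = adjoint_op A \<odot> A"
    using selfadjoint_sqrt_of_adjoint_comp_exists[OF A] by metis
  from someI_ex[OF this]
  show "nonneg_selfadjoint (abs_op A)" "abs_op A \<odot> abs_op A = adjoint_op A \<odot> A"
    by (simp_all add: abs_op_def sqrt_op_def)
qed

lemma real_adjoint_nonneg_selfadjoint: "nonneg_selfadjoint T \<Longrightarrow> real_adjoint T = T"
  using adjoint_op_eq_real_adjoint by (auto simp: nonneg_selfadjoint_def)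

text \<open>Self-adjointness turns the square of \<open>abs_op A\<close> into its product with its
  own adjoint, so the two operators share this product and the graph transfer applies.\<close>

lemma abs_op_transfer:
  fixes A :: "('a::complex_hilbert, 'b::complex_hilbert) op_graph"
  assumes A: "linear_operator A" "densely_defined A" "closed A" and "(x, y) \<in> abs_op A"
  obtains z where "(x, z) \<in> A" "norm z = norm y"
proof (rule graph_transfer_same_adjoint_comp[OF _ _ _ _ _ _ _ assms(4), of A])
  note T = abs_op_properties[OF A]
  have lT: "linear_operator (abs_op A)" using T(1) by (simp add: nonneg_selfadjoint_def)
  show "subspace (abs_op A)" "single_valued (abs_op A)"
    using lT by (simp_all add: linear_operator_imp_subspace single_valued_linear_operator)
  show "closed (abs_op A)"
    using closed_real_adjoint real_adjoint_nonneg_selfadjoint[OF T(1)] by metis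
  show "abs_op A O real_adjoint (abs_op A) = A O real_adjoint A"
    using T by (simp add: real_adjoint_nonneg_selfadjoint adjoint_op_eq_real_adjoint[OF A(1)])
qed (use A that in \<open>simp_all add: linear_operator_imp_subspace single_valued_linear_operator\<close>)

subsection \<open>Differentiation on the half-line\<close>

lemma at_within_half_line_neq_bot: "0 \<le> t \<Longrightarrow> at t within {0..} \<noteq> bot" for t :: real
  using islimpt_subset[of t "{t..t + 1}" "{0..}"] by (simp add: trivial_limit_within)

lemma differentiable_on_half_line_tderiv:
  "f differentiable_on {0..} \<Longrightarrow> 0 \<le> t \<Longrightarrow> (f has_vector_derivative tderiv f t) (at t within {0..})"
  unfolding tderiv_def differentiable_on_def by (simp add: vector_derivative_works)

text \<open>A functional vanishing on \<open>M\<close> vanishes along the curve, hence on its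
  derivative. For a graph \<open>M\<close>, this differentiates both components at once.\<close>

lemma derivative_in_closed_subspace:
  fixes M :: "'a::{real_inner,banach} set"
  assumes M: "subspace M" "closed M" and "0 \<le> t"
    and "\<And>s. 0 \<le> s \<Longrightarrow> f s \<in> M" and f: "(f has_vector_derivative f') (at t within {0..})"
  shows "f' \<in> M"
proof (rule mem_subspace_if_orthogonal_orthogonal[OF M])
  fix z assume z: "\<And>m. m \<in> M \<Longrightarrow> z \<bullet> m = 0"
  have "((\<lambda>s. z \<bullet> f s) has_vector_derivative z \<bullet> f') (at t within {0..})"
    by (rule bounded_linear.has_vector_derivative[OF bounded_linear_inner_right f])
  moreover have "((\<lambda>s. z \<bullet> f s) has_vector_derivative 0) (at t within {0..})"
    using assms z by (intro has_vector_derivative_transform[OF _ _ has_vector_derivative_const[of 0]]) auto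
  ultimately show "z \<bullet> f' = 0"
    using vector_derivative_unique_within at_within_half_line_neq_bot \<open>0 \<le> t\<close> by blast
qed

text \<open>
  Up to a constant, \<open>y\<close> is recovered as the antiderivative of \<open>v\<close>, because the curve
  \<open>(u - u 0, \<integral>v)\<close> has its derivative, hence itself, in the closed graph of \<open>B\<close>.
\<close>

lemma closed_operator_has_vector_derivative:
  fixes B :: "('a::{real_inner,banach} \<times> 'b::{real_inner,banach}) set"
  assumes B: "subspace B" "closed B" "single_valued B"
    and u: "\<And>s. 0 \<le> s \<Longrightarrow> (u has_vector_derivative u' s) (at s within {0..})"
    and uy: "\<And>s. 0 \<le> s \<Longrightarrow> (u s, y s) \<in> B"
    and uv: "\<And>s. 0 \<le> s \<Longrightarrow> (u' s, v s) \<in> B"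
    and v: "continuous_on {0..} v" and "0 \<le> t"
  shows "(y has_vector_derivative v t) (at t within {0..})"
proof -
  define q where "q s = integral {0..s} v" for s
  have q: "(q has_vector_derivative v s) (at s within {0..t + 1})" if "s \<in> {0..t + 1}" for s
    unfolding q_def using that v
    by (intro integral_has_vector_derivative continuous_on_subset[OF v]) auto
  have u_Icc: "(u has_vector_derivative u' s) (at s within {0..t + 1})" if "s \<in> {0..t + 1}" for s
    using that by (intro has_vector_derivative_within_subset[OF u]) auto
  have y_eq: "y s = q s + y 0" if s: "s \<in> {0..t + 1}" for s
  proof -
    have "(u s - u 0, q s) \<in> B"
    proof (rule mem_subspace_if_orthogonal_orthogonal[OF B(1,2)])
      fix z assume z: "\<And>m. m \<in> B \<Longrightarrow> z \<bullet> m = 0"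
      have D0: "((\<lambda>s. z \<bullet> (u s - u 0, q s)) has_vector_derivative 0) (at r within {0..t + 1})"
        if r: "r \<in> {0..t + 1}" for r
      proof -
        have "((\<lambda>s. (u s - u 0, q s)) has_vector_derivative (u' r - 0, v r)) (at r within {0..t + 1})"
          by (intro has_vector_derivative_Pair has_vector_derivative_diff u_Icc q
            has_vector_derivative_const r)
        from bounded_linear.has_vector_derivative[OF bounded_linear_inner_right this, of z]
        show ?thesis using z[OF uv[of r]] r by simp
      qed
      obtain c where c: "z \<bullet> (u r - u 0, q r) = c" if "r \<in> {0..t + 1}" for r
        using has_vector_derivative_zero_constant[OF convex_real_interval(5) D0] by blast
      from c[of s] c[of 0] show "z \<bullet> (u s - u 0, q s) = 0"
        using s \<open>0 \<le> t\<close> by (simp add: q_def zero_prod_def[symmetric])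
    qed
    moreover have "(u s - u 0, y s - y 0) \<in> B"
      using subspace_diff[OF B(1) uy uy, of s 0] s by simp
    ultimately have "q s = y s - y 0" using B(3) by (auto dest: single_valuedD)
    then show ?thesis by simp
  qed
  have "(y has_vector_derivative v t + 0) (at t within {0..t + 1})"
    using \<open>0 \<le> t\<close>
    by (intro has_vector_derivative_transform[OF _ y_eq] has_vector_derivative_add q
      has_vector_derivative_const) auto
  \<comment> \<open>The interval was extended past \<open>t\<close> so that \<open>t\<close> is no
    right endpoint and the two filters agree.\<close>
  moreover have "at t within {0..t + 1} = at t within {0..}"
    by (rule at_within_nhd[of _ "{..<t + 1}"]) auto
  ultimately show ?thesis by simp
qed

subsection \<open>Conservation of energy\<close>

lemma app_eq: "single_valued A \<Longrightarrow> (x, y) \<in> A \<Longrightarrow> app A x = y"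
  unfolding app_def by (blast dest: single_valuedD)

lemma app_mem: "single_valued A \<Longrightarrow> x \<in> Domain A \<Longrightarrow> (x, app A x) \<in> A"
  by (auto simp: app_eq)

theorem lemma5p9:
  fixes A :: "('a::complex_hilbert, 'b::complex_hilbert) op_graph"
    and B R :: "('a, 'a) op_graph"
    and u :: "real \<Rightarrow> 'a"
  assumes "separable_space (euclidean :: 'a topology)"
    and "separable_space (euclidean :: 'b topology)"
    and "linear_operator A" and "densely_defined A" and "closed A"
    and "linear_operator B" and "closed B"
    and "B \<odot> abs_op A \<subseteq> abs_op A \<odot> B"
    and "linear_operator R" and "densely_defined R" and "closable R"
    and "Domain A \<subseteq> Domain R"
    and "classical_solution R (adjoint_op A \<odot> A) u"
    and "\<forall>t\<ge>0. u t \<in> Domain (B \<odot> abs_op A)"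
    and "C1 (\<lambda>t. app (B \<odot> abs_op A) (u t))"
    and "\<forall>t\<ge>0. tderiv u t \<in> Domain B"
    and "C1 (\<lambda>t. app B (tderiv u t))"
    and "\<forall>t\<ge>0. app R (tderiv u t) \<in> Domain B"
  defines "energy \<equiv> \<lambda>t. (norm (app B (tderiv u t)))\<^sup>2 + (norm (app (A \<odot> B) (u t)))\<^sup>2"
    and "rhs \<equiv> \<lambda>t. - 2 * Re (cinner (app B (tderiv u t)) (app (B \<odot> R) (tderiv u t)))"
  shows "(\<forall>t\<ge>0. u t \<in> Domain (A \<odot> B)) \<and>
    (\<forall>t\<ge>0. (energy has_real_derivative rhs t) (at t within {0..})) \<and>
    ((\<forall>x\<in>Domain R. app R x = 0) \<longrightarrow>
       (\<forall>t\<ge>0. rhs t = 0) \<and> (\<exists>c. \<forall>t\<ge>0. energy t = c))"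
proof -
  define T where "T = abs_op A"
  define S where "S = adjoint_op A \<odot> A"
  define v where "v t = app B (tderiv u t)" for t
  define w where "w t = app (B \<odot> T) (u t)" for t
  define y where "y t = app B (u t)" for t
  note A = assms(3-5)
  have nT: "nonneg_selfadjoint T" and TT: "T O T = S"
    using abs_op_properties[OF A] by (simp_all add: T_def S_def)
  have lT: "linear_operator T" using nT by (simp add: nonneg_selfadjoint_def)
  have adjT: "real_adjoint T = T" using nT by (rule real_adjoint_nonneg_selfadjoint)
  have closedT: "closed T" using closed_real_adjoint adjT by metis
  note sv = assms(3,6,9)[THEN single_valued_linear_operator] lT[THEN single_valued_linear_operator]
  note sub = assms(3,6)[THEN linear_operator_imp_subspace] lT[THEN linear_operator_imp_subspace]
  have svS: "single_valued S" unfolding TT[symmetric] by (intro single_valued_relcomp sv)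
  have C2: "C2 u"
    and uS: "\<And>t. 0 \<le> t \<Longrightarrow> (u t, app S (u t)) \<in> S"
    and uR: "\<And>t. 0 \<le> t \<Longrightarrow> (tderiv u t, app R (tderiv u t)) \<in> R"
    and eqn: "\<And>t. 0 \<le> t \<Longrightarrow> tderiv (tderiv u) t + app R (tderiv u t) + app S (u t) = 0"
    using assms(13) svS sv by (auto simp: classical_solution_def S_def intro!: app_mem)
  have u': "(u has_vector_derivative tderiv u t) (at t within {0..})"
    and u'': "(tderiv u has_vector_derivative tderiv (tderiv u) t) (at t within {0..})"
    and v': "(v has_vector_derivative tderiv v t) (at t within {0..})"
    and w': "(w has_vector_derivative tderiv w t) (at t within {0..})" if "0 \<le> t" for t
    using C2 assms(15,17) that
    by (auto simp: C2_def C1_def v_def[abs_def] w_def[abs_def] T_def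
        intro!: differentiable_on_half_line_tderiv)
  have cont_v: "continuous_on {0..} v"
    using v' by (intro continuous_on_vector_derivative) auto
  have uv: "(tderiv u t, v t) \<in> B" if "0 \<le> t" for t
    using that assms(16) sv unfolding v_def by (intro app_mem) auto
  have uTB: "(u t, w t) \<in> T O B" if "0 \<le> t" for t
    using that assms(14) sv unfolding w_def T_def by (intro app_mem single_valued_relcomp) auto
  \<comment> \<open>Here the commutation hypothesis puts \<open>u t\<close> in the domain of
    \<open>B\<close> and rewrites \<open>w\<close> as \<open>T\<close> applied to
    \<open>B u\<close>.\<close>
  have "\<exists>z. (u t, z) \<in> B \<and> (z, w t) \<in> T" if "0 \<le> t" for t
    using uTB[OF that] assms(8) unfolding T_def by blast
  then have uy: "(u t, y t) \<in> B" and yw: "(y t, w t) \<in> T" if "0 \<le> t" for t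
    using that app_eq[OF sv(2)] unfolding y_def by metis+
  have y': "(y has_vector_derivative v t) (at t within {0..})" if "0 \<le> t" for t
    using closed_operator_has_vector_derivative[OF sub(2) assms(7) sv(2) u' uy uv cont_v that] .
  have Bv': "(tderiv (tderiv u) t, tderiv v t) \<in> B" if "0 \<le> t" for t
    using derivative_in_closed_subspace[OF sub(2) assms(7) that uv
      has_vector_derivative_Pair[OF u'' v']] that by simp
  have Tw': "(v t, tderiv w t) \<in> T" if "0 \<le> t" for t
    using derivative_in_closed_subspace[OF sub(3) closedT that yw
      has_vector_derivative_Pair[OF y' w']] that by simp
  have ABu: "\<exists>z. (u t, z) \<in> B O A \<and> norm z = norm (w t)" if "0 \<le> t" for t
    using abs_op_transfer[OF A, of "y t" "w t"] yw[OF that] uy[OF that] unfolding T_def by blast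
  have norm_ABu: "norm (app (A \<odot> B) (u t)) = norm (w t)" if "0 \<le> t" for t
    using ABu[OF that] app_eq[OF single_valued_relcomp[OF sv(2,1)]] by metis
  define r where "r t = app B (app R (tderiv u t))" for t
  have BR: "(app R (tderiv u t), r t) \<in> B" if "0 \<le> t" for t
    using that assms(18) sv unfolding r_def by (intro app_mem) auto
  have Tw: "(w t, - tderiv v t - r t) \<in> T" if t: "0 \<le> t" for t
  proof -
    \<comment> \<open>\<open>a\<close> is \<open>T u\<close>, whose image under \<open>B\<close> is
      \<open>w t\<close>. The equation puts \<open>T a\<close> in the domain of \<open>B\<close>, so
      commutation moves \<open>B\<close> past \<open>T\<close> at \<open>a\<close>.\<close>
    obtain a where a: "(u t, a) \<in> T" "(a, app S (u t)) \<in> T"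
      using uS[OF t] unfolding TT[symmetric] by blast
    have aw: "(a, w t) \<in> B" using uTB[OF t] a(1) sv(4) by (auto dest: single_valuedD)
    have "app S (u t) = - tderiv (tderiv u) t - app R (tderiv u t)"
      using eqn[OF t] by (simp add: eq_neg_iff_add_eq_0 algebra_simps)
    then have "(app S (u t), - tderiv v t - r t) \<in> B"
      using subspace_diff[OF sub(2) subspace_neg[OF sub(2) Bv'[OF t]] BR[OF t]] by simp
    then have "(a, - tderiv v t - r t) \<in> B \<odot> abs_op A" using a(2) T_def by blast
    then obtain c where "(a, c) \<in> B" "(c, - tderiv v t - r t) \<in> T"
      using assms(8) unfolding T_def by blast
    then show ?thesis using aw sv(2) by (auto dest: single_valuedD)
  qed
  \<comment> \<open>Symmetry of \<open>T\<close>, applied to the graph points over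
    \<open>w t\<close> and \<open>v t\<close>.\<close>
  have inner_w: "tderiv w t \<bullet> w t = - (v t \<bullet> tderiv v t) - v t \<bullet> r t" if "0 \<le> t" for t
    using real_adjointD[of "w t" "- tderiv v t - r t" T "v t" "tderiv w t"] Tw[OF that] Tw'[OF that]
    by (simp add: adjT inner_diff_right)
  have BRu: "app (B \<odot> R) (tderiv u t) = r t" if "0 \<le> t" for t
    using uR[OF that] BR[OF that] sv by (intro app_eq single_valued_relcomp) auto
  have rhs: "rhs t = - 2 * (v t \<bullet> r t)" if "0 \<le> t" for t
    by (simp add: rhs_def BRu[OF that] v_def inner_eq_Re_cinner)
  have energy: "energy t = v t \<bullet> v t + w t \<bullet> w t" if "0 \<le> t" for t
    unfolding energy_def norm_ABu[OF that] by (simp add: v_def power2_norm_eq_inner)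
  have deriv: "(energy has_real_derivative rhs t) (at t within {0..})" if t: "0 \<le> t" for t
  proof -
    have "((\<lambda>t. v t \<bullet> v t + w t \<bullet> w t) has_vector_derivative
        (v t \<bullet> tderiv v t + tderiv v t \<bullet> v t) + (w t \<bullet> tderiv w t + tderiv w t \<bullet> w t))
        (at t within {0..})"
      by (intro has_vector_derivative_add bounded_bilinear.has_vector_derivative[OF bounded_bilinear_inner]
        v' w' t)
    also have "(v t \<bullet> tderiv v t + tderiv v t \<bullet> v t) + (w t \<bullet> tderiv w t + tderiv w t \<bullet> w t) = rhs t"
      using inner_w[OF t] rhs[OF t] by (simp add: inner_commute)
    finally show ?thesis
      unfolding has_real_derivative_iff_has_vector_derivative
      using t energy by (intro has_vector_derivative_transform[of t "{0..}" energy]) auto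
  qed
  have rhs_0: "rhs t = 0" if R0: "\<forall>x\<in>Domain R. app R x = 0" and t: "0 \<le> t" for t
  proof -
    have "app R (tderiv u t) = 0" using R0 uR[OF t] by blast
    \<comment> \<open>Linearity of \<open>B\<close>: its value at 0 is 0.\<close>
    then have "r t = 0" using BR[OF t] single_valued_subspaceD[OF sv(2) sub(2)] by simp
    then show ?thesis using rhs[OF t] by simp
  qed
  have energy_const: "\<exists>c. \<forall>t\<ge>0. energy t = c" if R0: "\<forall>x\<in>Domain R. app R x = 0"
  proof -
    have "\<exists>c. \<forall>t\<in>{0..}. energy t = c"
    proof (rule has_field_derivative_zero_constant)
      show "(energy has_real_derivative 0) (at t within {0..})" if "t \<in> {0..}" for t
        using deriv[of t] rhs_0[OF R0, of t] that by simp
    qed simp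
    then obtain c where "energy t = c" if "t \<in> {0..}" for t by blast
    then have "\<forall>t\<ge>0. energy t = c" by simp
    then show ?thesis by blast
  qed
  show ?thesis
  proof (intro conjI impI allI)
    show "u t \<in> Domain (A \<odot> B)" if "0 \<le> t" for t using ABu[OF that] by blast
    show "(energy has_real_derivative rhs t) (at t within {0..})" if "0 \<le> t" for t
      using that by (rule deriv)
    show "rhs t = 0" if "\<forall>x\<in>Domain R. app R x = 0" "0 \<le> t" for t
      using that by (rule rhs_0)
    show "\<exists>c. \<forall>t\<ge>0. energy t = c" if "\<forall>x\<in>Domain R. app R x = 0"
      using that by (rule energy_const)
  qed
qed

end
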